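(* Let $F$ be a field of characteristic not $2$, let $L/F$ be a biquadratic field extension and let $\alpha\in L$ be a biquadratic generator with minimal polynomial $P(X)=X^4+uX^2+w$ over $F$. The following are equivalent: \begin{enumerate} \item $L/F$ is a Galois extension; \item $u^2-4w$, $-u+2\omega$ and $-u-2\omega$ lie in $L^2$, where $\omega$ is an element of an algebraic closure of $F$ with $\omega^2=w$; \item $w\in L^2$. \end{enumerate}
   Context: $F$ is a field of characteristic different from $2$. A quartic extension $L/F$ is biquadratic if it has a primitive element $\alpha$ (a biquadratic generator) whose minimal polynomial over $F$ is of the form $X^4+uX^2+w$ with $u,w\in F$. $L^2$ denotes the set of squares in $L$. *)

theory Defs
  imports "HOL-Algebra.Algebraic_Closure" "HOL-Algebra.Generated_Fields"
begin

text \<open>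
  Field extensions $E/K$ are pairs of subfields $K \subseteq E$ of an ambient ring $R$, as in the
  library's theory of finite extensions. Polynomials are coefficient lists, leading coefficient first.
\<close>

definition (in ring) subfield_extension :: "'a set \<Rightarrow> 'a set \<Rightarrow> bool"
  where "subfield_extension K E \<longleftrightarrow> subfield K R \<and> subfield E R \<and> K \<subseteq> E"

definition (in ring) relative_automorphisms :: "'a set \<Rightarrow> 'a set \<Rightarrow> ('a \<Rightarrow> 'a) set"
  where "relative_automorphisms K E =
    {\<sigma> \<in> ring_iso (R\<lparr>carrier := E\<rparr>) (R\<lparr>carrier := E\<rparr>). \<forall>x\<in>K. \<sigma> x = x}"

text \<open>
  Galois in the sense of Artin and Bourbaki: algebraic, and the fixed field of the group of
  $K$-automorphisms of $E$ is $K$.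
\<close>

definition (in ring) galois_extension :: "'a set \<Rightarrow> 'a set \<Rightarrow> bool"
  where "galois_extension K E \<longleftrightarrow>
    subfield_extension K E \<and>
    (\<forall>x\<in>E. (algebraic over K) x) \<and>
    {x \<in> E. \<forall>\<sigma> \<in> relative_automorphisms K E. \<sigma> x = x} = K"

definition (in ring) biquadratic_poly :: "'a \<Rightarrow> 'a \<Rightarrow> 'a list"
  where "biquadratic_poly u w = [\<one>, \<zero>, u, \<zero>, w]"

text \<open>
  The term \<open>Irr K \<alpha>\<close> is a definite description, meaningful only for algebraic \<open>\<alpha>\<close>;
  hence the explicit algebraicity condition.
\<close>

definition (in ring) biquadratic_generator :: "'a set \<Rightarrow> 'a set \<Rightarrow> 'a \<Rightarrow> bool"
  where "biquadratic_generator K E \<alpha> \<longleftrightarrow>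
    \<alpha> \<in> E \<and> (algebraic over K) \<alpha> \<and> generate_field R (insert \<alpha> K) = E \<and>
    (\<exists>u\<in>K. \<exists>w\<in>K. Irr K \<alpha> = biquadratic_poly u w)"

definition (in ring) biquadratic_extension :: "'a set \<Rightarrow> 'a set \<Rightarrow> bool"
  where "biquadratic_extension K E \<longleftrightarrow>
    subfield_extension K E \<and> dimension 4 K E \<and> (\<exists>\<alpha>. biquadratic_generator K E \<alpha>)"

definition (in ring) squares :: "'a set \<Rightarrow> 'a set"
  where "squares E = (\<lambda>x. x [^] (2::nat)) ` E"

end

theory Submission
  imports Defs
begin

text \<open>
  Vieta's formulas turn all conditions into statements about two roots \<open>\<alpha>, \<beta>\<close> of \<open>P\<close> whose squares are
  the two roots of \<open>Y\<^sup>2 + uY + w\<close>: then \<open>w = (\<alpha>\<beta>)\<^sup>2\<close>, \<open>-u \<plusminus> 2\<alpha>\<beta> = (\<alpha> \<plusminus> \<beta>)\<^sup>2\<close> and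
  \<open>u\<^sup>2 - 4w = (\<alpha>\<^sup>2 - \<beta>\<^sup>2)\<^sup>2\<close>. If \<open>L/F\<close> is Galois, some automorphism moves \<open>\<alpha>\<^sup>2 \<notin> F\<close>, and the image
  of \<open>\<alpha>\<close> serves as \<open>\<beta>\<close>. Conversely, if \<open>\<omega> \<in> L\<close>, then \<open>\<beta> = \<omega>/\<alpha>\<close> lies in \<open>L\<close>, and
  the automorphisms \<open>\<alpha> \<mapsto> -\<alpha>\<close> and \<open>\<alpha> \<mapsto> \<beta>\<close> cut the fixed field down to \<open>F(\<alpha>\<^sup>2)\<close> and then to \<open>F\<close>.
\<close>

section \<open>Quadratic polynomials and squares\<close>

definition (in ring) monic_quadratic :: "'a \<Rightarrow> 'a \<Rightarrow> 'a \<Rightarrow> 'a"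
  where "monic_quadratic b c x = x \<otimes> x \<oplus> b \<otimes> x \<oplus> c"

lemma (in cring) monic_quadratic_of_roots:
  assumes "x \<in> carrier R" "y \<in> carrier R"
  shows "monic_quadratic (\<ominus> (x \<oplus> y)) (x \<otimes> y) y = \<zero>"
  unfolding monic_quadratic_def using assms by algebra

lemma (in domain) monic_quadratic_roots_product:
  assumes closed: "b \<in> carrier R" "c \<in> carrier R" "x \<in> carrier R" "y \<in> carrier R"
    and roots: "monic_quadratic b c x = \<zero>" "monic_quadratic b c y = \<zero>"
    and distinct: "x \<noteq> y"
  shows "x \<otimes> y = c"
proof -
  have "(x \<ominus> y) \<otimes> (x \<oplus> y \<oplus> b) = monic_quadratic b c x \<ominus> monic_quadratic b c y"
    unfolding monic_quadratic_def using closed by algebra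
  also have "\<dots> = \<zero>"
    unfolding roots by simp
  finally have sum: "x \<oplus> y \<oplus> b = \<zero>"
    using distinct closed integral_iff by simp
  have "x \<otimes> y = x \<otimes> (x \<oplus> y \<oplus> b) \<oplus> c \<ominus> monic_quadratic b c x"
    unfolding monic_quadratic_def using closed by algebra
  then show ?thesis
    using closed by (simp add: sum roots a_minus_def)
qed

lemma (in domain) monic_quadratic_root_sum:
  assumes closed: "b \<in> carrier R" "x \<in> carrier R" "y \<in> carrier R"
    and root: "monic_quadratic b (x \<otimes> y) x = \<zero>" and nonzero: "x \<noteq> \<zero>"
  shows "b = \<ominus> (x \<oplus> y)"
proof -
  have "x \<otimes> (b \<oplus> (x \<oplus> y)) = monic_quadratic b (x \<otimes> y) x"
    unfolding monic_quadratic_def using closed by algebra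
  then have "b \<oplus> (x \<oplus> y) = \<zero>"
    using root nonzero closed integral_iff by simp
  then show ?thesis
    using sum_zero_eq_neg closed by simp
qed

lemma (in domain) double_eq_zero_iff:
  assumes "\<one> \<oplus> \<one> \<noteq> \<zero>" "x \<in> carrier R"
  shows "x \<oplus> x = \<zero> \<longleftrightarrow> x = \<zero>"
proof -
  have "x \<oplus> x = (\<one> \<oplus> \<one>) \<otimes> x"
    using assms(2) by algebra
  then show ?thesis
    using assms integral_iff by simp
qed

lemma (in ring) double_mem_subfield_iff:
  assumes K: "subfield K R" and char: "\<one> \<oplus> \<one> \<noteq> \<zero>" and x: "x \<in> carrier R"
  shows "x \<oplus> x \<in> K \<longleftrightarrow> x \<in> K"
proof
  note K_ring = subringE[OF subfieldE(1)[OF K]]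
  have "x \<oplus> x = (\<one> \<oplus> \<one>) \<otimes> x"
    using x by algebra
  then show "x \<in> K" if "x \<oplus> x \<in> K"
    using subfield_m_inv_simprule[OF K _ x, of "\<one> \<oplus> \<one>"] that char K_ring(3,7) by simp
  show "x \<oplus> x \<in> K" if "x \<in> K"
    using K_ring(7) that by blast
qed

lemma (in domain) square_eq_square_iff:
  assumes "x \<in> carrier R" "y \<in> carrier R"
  shows "x \<otimes> x = y \<otimes> y \<longleftrightarrow> x = y \<or> x = \<ominus> y"
proof -
  have "x \<otimes> x = y \<otimes> y \<longleftrightarrow> (x \<ominus> y) \<otimes> (x \<oplus> y) = \<zero>"
  proof -
    have "(x \<ominus> y) \<otimes> (x \<oplus> y) = x \<otimes> x \<ominus> y \<otimes> y"
      using assms by algebra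
    then show ?thesis
      using assms by simp
  qed
  also have "\<dots> \<longleftrightarrow> x = y \<or> x = \<ominus> y"
    using assms integral_iff sum_zero_eq_neg by (auto simp: l_neg)
  finally show ?thesis .
qed

lemma (in ring) mem_squares_iff:
  assumes "E \<subseteq> carrier R"
  shows "x \<in> squares E \<longleftrightarrow> (\<exists>y\<in>E. y \<otimes> y = x)"
  using assms unfolding squares_def by (force simp: numeral_2_eq_2 image_iff)

lemma (in domain) square_mem_squares_iff:
  assumes E: "subring E R" and x: "x \<in> carrier R"
  shows "x \<otimes> x \<in> squares E \<longleftrightarrow> x \<in> E"
proof
  note E_ring = subringE[OF E]
  assume "x \<otimes> x \<in> squares E"
  then obtain y where "y \<in> E" "x \<otimes> x = y \<otimes> y"
    using mem_squares_iff[OF E_ring(1)] by metis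
  then show "x \<in> E"
    using square_eq_square_iff[OF x] E_ring(1,5) by blast
qed (use mem_squares_iff[OF subringE(1)[OF E]] in blast)

section \<open>Simple extensions\<close>

lemma (in cring) simple_extension_even_odd:
  assumes K: "subring K R" and x: "x \<in> carrier R" and y: "y \<in> simple_extension K x"
  obtains a b where "a \<in> simple_extension K (x \<otimes> x)" "b \<in> simple_extension K (x \<otimes> x)"
    and "y = a \<oplus> b \<otimes> x"
proof -
  have closed: "simple_extension K (x \<otimes> x) \<subseteq> carrier R" "K \<subseteq> carrier R"
    using simple_extension_in_carrier subringE(1)[OF K] x by auto
  from y have "\<exists>a\<in>simple_extension K (x \<otimes> x). \<exists>b\<in>simple_extension K (x \<otimes> x). y = a \<oplus> b \<otimes> x"
  proof (induction rule: simple_extension.induct)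
    case zero
    show ?case
      using x by (intro bexI[of _ \<zero>]) auto
  next
    case (lin y k)
    then obtain a b where ab: "a \<in> simple_extension K (x \<otimes> x)" "b \<in> simple_extension K (x \<otimes> x)"
      and y: "y = a \<oplus> b \<otimes> x"
      by blast
    have "a \<in> carrier R" "b \<in> carrier R" "k \<in> carrier R"
      using ab lin.hyps(2) closed by auto
    then have "y \<otimes> x \<oplus> k = (b \<otimes> (x \<otimes> x) \<oplus> k) \<oplus> a \<otimes> x"
      unfolding y using x by algebra
    then show ?case
      using ab(1) simple_extension.lin[OF ab(2) lin.hyps(2)] by blast
  qed
  then show thesis
    using that by blast
qed

lemma (in cring) simple_extension_quadratic_root:
  assumes K: "subring K R" and bc: "b \<in> K" "c \<in> K"
    and s: "s \<in> carrier R" "monic_quadratic b c s = \<zero>"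
    and y: "y \<in> simple_extension K s"
  obtains k l where "k \<in> K" "l \<in> K" "y = k \<otimes> s \<oplus> l"
proof -
  note K_ring = subringE[OF K]
  from y have "\<exists>k\<in>K. \<exists>l\<in>K. y = k \<otimes> s \<oplus> l"
  proof (induction rule: simple_extension.induct)
    case zero
    show ?case
      using s(1) K_ring(2) by (intro bexI[of _ \<zero>]) auto
  next
    case (lin y m)
    then obtain k l where kl: "k \<in> K" "l \<in> K" and y: "y = k \<otimes> s \<oplus> l"
      by blast
    have closed: "b \<in> carrier R" "c \<in> carrier R" "k \<in> carrier R" "l \<in> carrier R" "m \<in> carrier R"
      using bc kl lin.hyps(2) K_ring(1) by auto
    then have "y \<otimes> s \<oplus> m =
        k \<otimes> monic_quadratic b c s \<oplus> ((l \<oplus> \<ominus> (k \<otimes> b)) \<otimes> s \<oplus> (m \<oplus> \<ominus> (k \<otimes> c)))"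
      unfolding y monic_quadratic_def using s(1) by algebra
    then have "y \<otimes> s \<oplus> m = (l \<oplus> \<ominus> (k \<otimes> b)) \<otimes> s \<oplus> (m \<oplus> \<ominus> (k \<otimes> c))"
      using s closed by simp
    moreover have "l \<oplus> \<ominus> (k \<otimes> b) \<in> K" "m \<oplus> \<ominus> (k \<otimes> c) \<in> K"
      using bc kl lin.hyps(2) K_ring(5-7) by auto
    ultimately show ?case
      by blast
  qed
  then show thesis
    using that by blast
qed

lemma (in field) generate_field_insert_algebraic:
  assumes K: "subfield K R" and x: "x \<in> carrier R" "(algebraic over K) x"
  shows "generate_field R (insert x K) = simple_extension K x"
proof (rule generate_fieldI[symmetric])
  show "insert x K \<subseteq> carrier R"
    using subfieldE(3)[OF K] x(1) by simp
  show "subfield (simple_extension K x) R"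
    using simple_extension_is_subfield[OF K x(1)] x(2) by simp
  show "insert x K \<subseteq> simple_extension K x"
    using simple_extension_incl[OF subfieldE(3)[OF K] x(1)]
      simple_extension_mem[OF subfieldE(1)[OF K] x(1)] by simp
  show "simple_extension K x \<subseteq> E" if "subfield E R" "insert x K \<subseteq> E" for E
    using simple_extension_subring_incl[OF subfieldE(1)[OF that(1)]] that(2) by simp
qed

lemma (in domain) degree_Irr_le:
  assumes K: "subfield K R" and x: "x \<in> carrier R" "(algebraic over K) x"
    and p: "p \<in> carrier (K[X])" "p \<noteq> []" "eval p x = \<zero>"
  shows "degree (Irr K x) \<le> degree p"
  using pdivides_imp_degree_le[OF subfieldE(1)[OF K] IrrE(1)[OF K x] p(1,2)]
    Irr_minimal[OF K x p(1,3)] by simp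

lemma (in domain) Irr_of_root:
  assumes K: "subfield K R" and x: "x \<in> carrier R" "(algebraic over K) x"
    and y: "y \<in> carrier R" "eval (Irr K x) y = \<zero>"
  shows "(algebraic over K) y" and "Irr K y = Irr K x"
proof -
  note irr = IrrE[OF K x]
  have "Irr K x \<noteq> []"
    using pirreducibleE(1)[OF subfieldE(1)[OF K] irr(1,2)] .
  then show alg: "(algebraic over K) y"
    using algebraicI[OF irr(1)] y(2) by blast
  show "Irr K y = Irr K x"
    using minimal_polynomial_is_unique[OF K y(1) alg] IrrE[OF K y(1) alg] irr y(2) by blast
qed

lemma (in ring) dimension_subset_eq:
  assumes K: "subfield K R" and dim: "dimension n K E" "dimension n K E'" and subset: "E \<subseteq> E'"
  shows "E = E'"
proof -
  obtain Us where "set Us \<subseteq> carrier R" "independent K Us" "length Us = n" "Span K Us = E"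
    using exists_base[OF K dim(1)] by blast
  then show ?thesis
    using independent_length_eq_dimension[OF K dim(2)] Span_base_incl[OF K] subset by blast
qed

lemma (in domain) simple_extension_eq_of_root:
  assumes K: "subfield K R" and x: "x \<in> carrier R" "(algebraic over K) x"
    and y: "y \<in> simple_extension K x" "eval (Irr K x) y = \<zero>"
  shows "simple_extension K y = simple_extension K x"
proof (rule dimension_subset_eq[OF K])
  have y_closed: "y \<in> carrier R"
    using y(1) simple_extension_in_carrier[OF subfieldE(3)[OF K] x(1)] by blast
  note root = Irr_of_root[OF K x y_closed y(2)]
  show "dimension (degree (Irr K x)) K (simple_extension K y)"
    using dimension_simple_extension[OF K y_closed root(1)] root(2) by simp
  show "dimension (degree (Irr K x)) K (simple_extension K x)"
    by (rule dimension_simple_extension[OF K x])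
  show "simple_extension K y \<subseteq> simple_extension K x"
    using simple_extension_subring_incl[OF simple_extension_is_subring[OF subfieldE(1)[OF K] x(1)]]
      simple_extension_incl[OF subfieldE(3)[OF K] x(1)] y(1) by blast
qed

section \<open>Automorphisms over a subfield\<close>

lemma ring_hom_images_iso:
  assumes h: "ring_hom_ring R S h" and g: "ring_hom_ring R T g"
    and same_kernel: "a_kernel R S h = a_kernel R T g"
  obtains \<phi> where "\<phi> \<in> ring_iso (S\<lparr>carrier := h ` carrier R\<rparr>) (T\<lparr>carrier := g ` carrier R\<rparr>)"
    and "\<And>a. a \<in> carrier R \<Longrightarrow> \<phi> (h a) = g a"
proof -
  interpret h: ring_hom_ring R S h by (rule h)
  interpret g: ring_hom_ring R T g by (rule g)
  interpret kernel: ideal "a_kernel R S h" R by (rule h.kernel_is_ideal)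
  let ?Q = "R Quot a_kernel R S h"
  define hq gq where "hq = (\<lambda>C. the_elem (h ` C))" and "gq = (\<lambda>C. the_elem (g ` C))"
  have hq: "hq \<in> ring_iso ?Q (S\<lparr>carrier := h ` carrier R\<rparr>)"
    and gq: "gq \<in> ring_iso ?Q (T\<lparr>carrier := g ` carrier R\<rparr>)"
    unfolding hq_def gq_def using h.FactRing_iso_set_aux g.FactRing_iso_set_aux same_kernel by auto
  let ?\<phi> = "gq \<circ> inv_into (carrier ?Q) hq"
  show thesis
  proof (rule that)
    show "?\<phi> \<in> ring_iso (S\<lparr>carrier := h ` carrier R\<rparr>) (T\<lparr>carrier := g ` carrier R\<rparr>)"
      using ring_iso_set_trans[OF ring_iso_set_sym[OF kernel.quotient_is_ring hq] gq] .
    show "?\<phi> (h a) = g a" if a: "a \<in> carrier R" for a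
    proof -
      let ?C = "a_kernel R S h +>\<^bsub>R\<^esub> a"
      have "?C \<in> carrier ?Q"
        using a unfolding FactRing_def A_RCOSETS_def' by auto
      moreover have "hq ?C = h a" and gq_coset: "gq ?C = g a"
        unfolding hq_def gq_def using a h.the_elem_simp g.the_elem_simp same_kernel by auto
      ultimately have "inv_into (carrier ?Q) hq (h a) = ?C"
        using inv_into_f_f[of hq "carrier ?Q" ?C] ring_iso_memE(5)[OF hq]
        unfolding bij_betw_def by simp
      then show ?thesis
        using gq_coset by simp
    qed
  qed
qed

lemma (in domain) simple_extension_iso:
  assumes K: "subfield K R" and x: "x \<in> carrier R" "(algebraic over K) x"
    and y: "y \<in> carrier R" "(algebraic over K) y" and Irr_eq: "Irr K x = Irr K y"
  obtains \<phi> where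
    "\<phi> \<in> ring_iso (R\<lparr>carrier := simple_extension K x\<rparr>) (R\<lparr>carrier := simple_extension K y\<rparr>)"
    and "\<phi> x = y" and "\<And>k. k \<in> K \<Longrightarrow> \<phi> k = k"
proof -
  note K_ring = subfieldE(1)[OF K] and K_carrier = subfieldE(3)[OF K]
  have same_kernel: "a_kernel (K[X]) R (\<lambda>p. eval p x) = a_kernel (K[X]) R (\<lambda>p. eval p y)"
    using Irr_generates_ker[OF K x] Irr_generates_ker[OF K y] Irr_eq by simp
  obtain \<phi> where iso: "\<phi> \<in> ring_iso (R\<lparr>carrier := (\<lambda>p. eval p x) ` carrier (K[X])\<rparr>)
      (R\<lparr>carrier := (\<lambda>p. eval p y) ` carrier (K[X])\<rparr>)"
    and eval: "\<And>p. p \<in> carrier (K[X]) \<Longrightarrow> \<phi> (eval p x) = eval p y"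
    using ring_hom_images_iso[OF eval_ring_hom[OF K_ring x(1)] eval_ring_hom[OF K_ring y(1)]
        same_kernel] by metis
  have "\<phi> x = y"
    using eval[OF var_closed(1)[OF K_ring]] x(1) y(1) by (simp add: eval_var)
  moreover have "\<phi> k = k" if k: "k \<in> K" for k
  proof -
    have "eval (poly_of_const k) z = k" if "z \<in> carrier R" for z
      using k K_carrier that eval_normalize[of "[k]" z] by (auto simp: poly_of_const_def)
    moreover have "poly_of_const k \<in> carrier (K[X])"
      using ring_hom_memE(1)[OF canonical_embedding_is_hom[OF K_ring]] k by simp
    ultimately show ?thesis
      using eval[of "poly_of_const k"] x(1) y(1) by simp
  qed
  ultimately show thesis
    using that iso simple_extension_as_eval_img[OF K_carrier] x(1) y(1) by simp
qed

lemma (in domain) relative_automorphism_of_root: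
  assumes K: "subfield K R" and x: "x \<in> carrier R" "(algebraic over K) x"
    and y: "y \<in> simple_extension K x" "eval (Irr K x) y = \<zero>"
  obtains \<phi> where "\<phi> \<in> relative_automorphisms K (simple_extension K x)" and "\<phi> x = y"
proof -
  have y_closed: "y \<in> carrier R"
    using y(1) simple_extension_in_carrier[OF subfieldE(3)[OF K] x(1)] by blast
  note root = Irr_of_root[OF K x y_closed y(2)]
  show thesis
    using simple_extension_iso[OF K x y_closed root(1) root(2)[symmetric]] that
    unfolding simple_extension_eq_of_root[OF assms] relative_automorphisms_def by blast
qed

lemma (in ring) galois_extensionI:
  assumes "subfield_extension K E"
    and "\<And>x. x \<in> E \<Longrightarrow> (algebraic over K) x"
    and "\<And>x. x \<in> E \<Longrightarrow> (\<And>\<phi>. \<phi> \<in> relative_automorphisms K E \<Longrightarrow> \<phi> x = x) \<Longrightarrow> x \<in> K"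
  shows "galois_extension K E"
  using assms unfolding galois_extension_def subfield_extension_def relative_automorphisms_def
  by auto

locale relative_automorphism = domain R for R (structure) +
  fixes K E :: "'a set" and \<phi> :: "'a \<Rightarrow> 'a"
  assumes extension: "subfield_extension K E"
    and automorphism: "\<phi> \<in> relative_automorphisms K E"
begin

lemma subfields: "subfield K R" "subfield E R" "K \<subseteq> E"
  using extension unfolding subfield_extension_def by auto

lemmas base_ring = subringE[OF subfieldE(1)[OF subfields(1)]]
  and top_ring = subringE[OF subfieldE(1)[OF subfields(2)]]

lemma hom_closed: "x \<in> E \<Longrightarrow> \<phi> x \<in> E"
  and hom_mult: "x \<in> E \<Longrightarrow> y \<in> E \<Longrightarrow> \<phi> (x \<otimes> y) = \<phi> x \<otimes> \<phi> y"
  and hom_add: "x \<in> E \<Longrightarrow> y \<in> E \<Longrightarrow> \<phi> (x \<oplus> y) = \<phi> x \<oplus> \<phi> y"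
  and fixes_base: "k \<in> K \<Longrightarrow> \<phi> k = k"
  using automorphism unfolding relative_automorphisms_def ring_iso_def ring_hom_def by auto

lemma hom_monic_quadratic:
  assumes "b \<in> K" "c \<in> K" "x \<in> E"
  shows "\<phi> (monic_quadratic b c x) = monic_quadratic b c (\<phi> x)"
proof -
  have "b \<in> E" "c \<in> E"
    using assms subfields(3) by auto
  then show ?thesis
    unfolding monic_quadratic_def using assms top_ring(6,7)
    by (simp add: hom_add hom_mult fixes_base)
qed

lemma fixes_simple_extension:
  assumes x: "x \<in> E" "\<phi> x = x" and y: "y \<in> simple_extension K x"
  shows "\<phi> y = y"
  using y
proof (induction rule: simple_extension.induct)
  case zero
  show ?case
    using fixes_base base_ring(2) by blast
next
  case (lin y k)
  have "y \<in> E" "k \<in> E"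
    using lin.hyps simple_extension_subring_incl[OF subfieldE(1)[OF subfields(2)] subfields(3) x(1)]
      subfields(3) by auto
  then show ?case
    using lin x top_ring(6) by (simp add: hom_add hom_mult fixes_base)
qed

lemma fixed_imp_mem_square_extension:
  assumes char: "\<one> \<oplus> \<one> \<noteq> \<zero>" and x: "x \<in> E" "x \<noteq> \<zero>" "\<phi> x = \<ominus> x"
    and y: "y \<in> simple_extension K x" "\<phi> y = y"
  shows "y \<in> simple_extension K (x \<otimes> x)"
proof -
  have x_closed: "x \<in> carrier R" and square: "x \<otimes> x \<in> E"
    using x(1) top_ring(1,6) by auto
  obtain a b where ab: "a \<in> simple_extension K (x \<otimes> x)" "b \<in> simple_extension K (x \<otimes> x)"
    and y_eq: "y = a \<oplus> b \<otimes> x"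
    using simple_extension_even_odd[OF subfieldE(1)[OF subfields(1)] x_closed y(1)] .
  have "\<phi> (x \<otimes> x) = x \<otimes> x"
    using x(1) x_closed by (simp add: hom_mult x(3) l_minus r_minus)
  then have fixed: "\<phi> a = a" "\<phi> b = b"
    using fixes_simple_extension[OF square] ab by auto
  have mem: "a \<in> E" "b \<in> E"
    using ab simple_extension_subring_incl[OF subfieldE(1)[OF subfields(2)] subfields(3) square]
    by auto
  then have closed: "a \<in> carrier R" "b \<in> carrier R"
    using top_ring(1) by auto
  have "b \<otimes> x \<oplus> b \<otimes> x = (a \<oplus> b \<otimes> x) \<ominus> (a \<oplus> b \<otimes> \<ominus> x)"
    using closed x_closed by algebra
  also have "a \<oplus> b \<otimes> \<ominus> x = \<phi> y"
    unfolding y_eq using mem x fixed top_ring(6) by (simp add: hom_add hom_mult)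
  also have "\<dots> = a \<oplus> b \<otimes> x"
    using y(2) y_eq by simp
  finally have "b \<otimes> x \<oplus> b \<otimes> x = \<zero>"
    using closed x_closed by simp
  then have "b \<otimes> x = \<zero>"
    using double_eq_zero_iff[OF char] closed x_closed by simp
  then show ?thesis
    using ab(1) y_eq closed(1) by simp
qed

lemma fixed_imp_mem_base:
  assumes bc: "b \<in> K" "c \<in> K" and s: "s \<in> E" "monic_quadratic b c s = \<zero>" "\<phi> s \<noteq> s"
    and y: "y \<in> simple_extension K s" "\<phi> y = y"
  shows "y \<in> K"
proof -
  have s_closed: "s \<in> carrier R" "\<phi> s \<in> carrier R"
    using s(1) hom_closed top_ring(1) by auto
  obtain k l where kl: "k \<in> K" "l \<in> K" and y_eq: "y = k \<otimes> s \<oplus> l"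
    using simple_extension_quadratic_root[OF subfieldE(1)[OF subfields(1)] bc s_closed(1) s(2) y(1)] .
  have mem: "k \<in> E" "l \<in> E" and closed: "k \<in> carrier R" "l \<in> carrier R"
    using kl subfields(3) base_ring(1) by auto
  have "k \<otimes> (\<phi> s \<ominus> s) = (k \<otimes> \<phi> s \<oplus> l) \<ominus> (k \<otimes> s \<oplus> l)"
    using closed s_closed by algebra
  also have "k \<otimes> \<phi> s \<oplus> l = \<phi> y"
    unfolding y_eq using kl mem s(1) top_ring(6) by (simp add: hom_add hom_mult fixes_base)
  also have "\<dots> = k \<otimes> s \<oplus> l"
    using y(2) y_eq by simp
  finally have "k \<otimes> (\<phi> s \<ominus> s) = \<zero>"
    using closed s_closed by simp
  then have "k = \<zero>"
    using s(3) closed s_closed integral_iff by simp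
  then show ?thesis
    using y_eq kl(2) closed s_closed by simp
qed

end

section \<open>Biquadratic extensions\<close>

lemma (in cring) eval_biquadratic_poly:
  assumes "u \<in> carrier R" "w \<in> carrier R" "x \<in> carrier R"
  shows "eval (biquadratic_poly u w) x = monic_quadratic u w (x \<otimes> x)"
proof -
  have "eval (biquadratic_poly u w) x = x \<otimes> (x \<otimes> (x \<otimes> x)) \<oplus> (u \<otimes> (x \<otimes> x) \<oplus> w)"
    unfolding biquadratic_poly_def using assms by (simp add: numeral_eq_Suc m_ac)
  also have "\<dots> = monic_quadratic u w (x \<otimes> x)"
    unfolding monic_quadratic_def using assms by algebra
  finally show ?thesis .
qed

lemma (in cring) biquadratic_square_identities:
  assumes "x \<in> carrier R" "y \<in> carrier R"
    and u_eq: "u = \<ominus> (x \<otimes> x \<oplus> y \<otimes> y)"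
  shows "(x \<otimes> x \<ominus> y \<otimes> y) \<otimes> (x \<otimes> x \<ominus> y \<otimes> y) =
      u [^] (2::nat) \<ominus> [(4::nat)] \<cdot> ((x \<otimes> y) [^] (2::nat))"
    and "(x \<oplus> y) \<otimes> (x \<oplus> y) = \<ominus> u \<oplus> [(2::nat)] \<cdot> (x \<otimes> y)"
    and "(x \<ominus> y) \<otimes> (x \<ominus> y) = \<ominus> u \<ominus> [(2::nat)] \<cdot> (x \<otimes> y)"
proof -
  have two: "[(2::nat)] \<cdot> z = z \<oplus> z" and four: "[(4::nat)] \<cdot> z = z \<oplus> z \<oplus> z \<oplus> z"
    and square: "z [^] (2::nat) = z \<otimes> z" if "z \<in> carrier R" for z
    using that by (simp_all add: numeral_eq_Suc)
  show "(x \<otimes> x \<ominus> y \<otimes> y) \<otimes> (x \<otimes> x \<ominus> y \<otimes> y) =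
      u [^] (2::nat) \<ominus> [(4::nat)] \<cdot> ((x \<otimes> y) [^] (2::nat))"
    using assms(1,2) by (simp add: four square u_eq) algebra
  show "(x \<oplus> y) \<otimes> (x \<oplus> y) = \<ominus> u \<oplus> [(2::nat)] \<cdot> (x \<otimes> y)"
    using assms(1,2) by (simp add: two u_eq) algebra
  show "(x \<ominus> y) \<otimes> (x \<ominus> y) = \<ominus> u \<ominus> [(2::nat)] \<cdot> (x \<otimes> y)"
    using assms(1,2) by (simp add: two u_eq) algebra
qed

locale biquadratic_simple_extension = field R for R (structure) +
  fixes K :: "'a set" and \<alpha> u w :: 'a
  assumes char: "\<one> \<oplus> \<one> \<noteq> \<zero>"
    and base_subfield: "subfield K R"
    and generator: "\<alpha> \<in> carrier R" "(algebraic over K) \<alpha>"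
    and coefficients: "u \<in> K" "w \<in> K"
    and minpoly: "Irr K \<alpha> = biquadratic_poly u w"
begin

abbreviation "L \<equiv> simple_extension K \<alpha>"

lemmas base_ring = subringE[OF subfieldE(1)[OF base_subfield]]

lemma coefficients_closed: "u \<in> carrier R" "w \<in> carrier R"
  using base_ring(1) coefficients by auto

lemma extension: "subfield_extension K L"
  unfolding subfield_extension_def
  using base_subfield simple_extension_is_subfield[OF base_subfield generator(1)] generator
    simple_extension_incl[OF base_ring(1) generator(1)] by simp

lemma subfield_L: "subfield L R" and base_subset_L: "K \<subseteq> L"
  using extension unfolding subfield_extension_def by auto

lemmas L_ring = subringE[OF subfieldE(1)[OF subfield_L]]

lemma generator_mem: "\<alpha> \<in> L"
  using simple_extension_mem[OF subfieldE(1)[OF base_subfield] generator(1)] .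

lemma eval_minpoly: "x \<in> carrier R \<Longrightarrow> eval (Irr K \<alpha>) x = monic_quadratic u w (x \<otimes> x)"
  unfolding minpoly by (rule eval_biquadratic_poly[OF coefficients_closed])

lemma generator_square_root: "monic_quadratic u w (\<alpha> \<otimes> \<alpha>) = \<zero>"
  using IrrE(4)[OF base_subfield generator] eval_minpoly[OF generator(1)] by simp

lemma generator_square_notin_base: "\<alpha> \<otimes> \<alpha> \<notin> K"
proof
  assume square: "\<alpha> \<otimes> \<alpha> \<in> K"
  let ?p = "[\<one>, \<zero>, \<ominus> (\<alpha> \<otimes> \<alpha>)]"
  have "?p \<in> carrier (K[X])"
    using square base_ring(2,3,5) unfolding univ_poly_def polynomial_def by simp
  moreover have "eval ?p \<alpha> = \<zero>"
    using generator(1) by (simp add: numeral_eq_Suc r_neg)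
  ultimately have "degree (Irr K \<alpha>) \<le> degree ?p"
    using degree_Irr_le[OF base_subfield generator] by blast
  then show False
    unfolding minpoly biquadratic_poly_def by simp
qed

lemma generator_nonzero: "\<alpha> \<noteq> \<zero>"
  using generator_square_notin_base base_ring(2) by auto

lemma galois_imp_constant_square:
  assumes galois: "galois_extension K L"
  shows "w \<in> squares L"
proof -
  have square: "\<alpha> \<otimes> \<alpha> \<in> L"
    using L_ring(6) generator_mem by blast
  then obtain \<phi> where \<phi>: "\<phi> \<in> relative_automorphisms K L" and moved: "\<phi> (\<alpha> \<otimes> \<alpha>) \<noteq> \<alpha> \<otimes> \<alpha>"
    using galois generator_square_notin_base unfolding galois_extension_def by blast
  interpret relative_automorphism R K L \<phi>
    by unfold_locales (use extension \<phi> in auto)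
  define \<beta> where "\<beta> = \<phi> \<alpha>"
  have \<beta>: "\<beta> \<in> L" "\<beta> \<in> carrier R" and \<beta>_square: "\<phi> (\<alpha> \<otimes> \<alpha>) = \<beta> \<otimes> \<beta>"
    unfolding \<beta>_def using hom_closed hom_mult generator_mem L_ring(1) by auto
  have "monic_quadratic u w (\<beta> \<otimes> \<beta>) = \<zero>"
    using hom_monic_quadratic[OF coefficients square] fixes_base[OF base_ring(2)]
    unfolding \<beta>_square generator_square_root by simp
  then have "(\<alpha> \<otimes> \<alpha>) \<otimes> (\<beta> \<otimes> \<beta>) = w"
    using monic_quadratic_roots_product[OF coefficients_closed _ _ generator_square_root]
      moved generator(1) \<beta>(2) unfolding \<beta>_square by simp
  then have "(\<alpha> \<otimes> \<beta>) \<otimes> (\<alpha> \<otimes> \<beta>) = w"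
    using generator(1) \<beta>(2) by (simp add: m_ac)
  then show ?thesis
    using mem_squares_iff[OF L_ring(1)] L_ring(6)[OF generator_mem \<beta>(1)] by blast
qed

lemma complementary_root:
  assumes y: "y \<in> L" "y \<otimes> y = w"
  obtains \<beta> where "\<beta> \<in> L" "\<alpha> \<otimes> \<beta> = y"
    and "u = \<ominus> (\<alpha> \<otimes> \<alpha> \<oplus> \<beta> \<otimes> \<beta>)" "w = (\<alpha> \<otimes> \<alpha>) \<otimes> (\<beta> \<otimes> \<beta>)"
proof -
  have inv: "inv \<alpha> \<in> L" "\<alpha> \<otimes> inv \<alpha> = \<one>"
    using subfield_m_inv[OF subfield_L] generator_mem generator_nonzero by auto
  define \<beta> where "\<beta> = inv \<alpha> \<otimes> y"
  have \<beta>: "\<beta> \<in> L" "\<beta> \<in> carrier R"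
    unfolding \<beta>_def using inv(1) y(1) L_ring(1,6) by auto
  have product: "\<alpha> \<otimes> \<beta> = y"
    unfolding \<beta>_def using inv y(1) L_ring(1) generator(1) by (simp add: m_assoc[symmetric] subset_iff)
  have w_eq: "w = (\<alpha> \<otimes> \<alpha>) \<otimes> (\<beta> \<otimes> \<beta>)"
    unfolding y(2)[symmetric] product[symmetric] using generator(1) \<beta>(2) by (simp add: m_ac)
  then have "u = \<ominus> (\<alpha> \<otimes> \<alpha> \<oplus> \<beta> \<otimes> \<beta>)"
    using monic_quadratic_root_sum[OF coefficients_closed(1), of "\<alpha> \<otimes> \<alpha>" "\<beta> \<otimes> \<beta>"]
      generator_square_root generator_nonzero generator(1) \<beta>(2) integral_iff by simp
  with \<beta>(1) product show thesis
    using w_eq by (rule that)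
qed

lemma fixed_imp_base:
  assumes \<phi>: "\<phi> \<in> relative_automorphisms K L" "\<phi> \<alpha> = \<ominus> \<alpha>"
    and \<psi>: "\<psi> \<in> relative_automorphisms K L" "\<psi> (\<alpha> \<otimes> \<alpha>) \<noteq> \<alpha> \<otimes> \<alpha>"
    and x: "x \<in> L" "\<phi> x = x" "\<psi> x = x"
  shows "x \<in> K"
proof -
  interpret \<phi>: relative_automorphism R K L \<phi>
    by unfold_locales (use extension \<phi> in auto)
  interpret \<psi>: relative_automorphism R K L \<psi>
    by unfold_locales (use extension \<psi> in auto)
  have "x \<in> simple_extension K (\<alpha> \<otimes> \<alpha>)"
    using \<phi>.fixed_imp_mem_square_extension[OF char generator_mem generator_nonzero \<phi>(2) x(1,2)] .
  then show ?thesis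
    using \<psi>.fixed_imp_mem_base[OF coefficients _ generator_square_root \<psi>(2) _ x(3)]
      L_ring(6) generator_mem by blast
qed

lemma negating_automorphism:
  obtains \<phi> where "\<phi> \<in> relative_automorphisms K L" "\<phi> \<alpha> = \<ominus> \<alpha>"
proof -
  have "eval (Irr K \<alpha>) (\<ominus> \<alpha>) = \<zero>"
    using generator_square_root generator(1) by (simp add: eval_minpoly l_minus r_minus)
  then show thesis
    using relative_automorphism_of_root[OF base_subfield generator L_ring(5)[OF generator_mem]] that
    by blast
qed

lemma automorphism_moving_generator_square:
  assumes "w \<in> squares L"
  obtains \<phi> where "\<phi> \<in> relative_automorphisms K L" "\<phi> (\<alpha> \<otimes> \<alpha>) \<noteq> \<alpha> \<otimes> \<alpha>"
proof -
  obtain y where y: "y \<in> L" "y \<otimes> y = w"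
    using assms mem_squares_iff[OF L_ring(1)] by blast
  obtain \<beta> where \<beta>: "\<beta> \<in> L"
    and u_eq: "u = \<ominus> (\<alpha> \<otimes> \<alpha> \<oplus> \<beta> \<otimes> \<beta>)" and w_eq: "w = (\<alpha> \<otimes> \<alpha>) \<otimes> (\<beta> \<otimes> \<beta>)"
    using complementary_root[OF y] by blast
  have "\<beta> \<in> carrier R"
    using \<beta> L_ring(1) by blast
  then have "eval (Irr K \<alpha>) \<beta> = \<zero>"
    using monic_quadratic_of_roots[of "\<alpha> \<otimes> \<alpha>" "\<beta> \<otimes> \<beta>"] generator(1)
    by (simp add: eval_minpoly u_eq[symmetric] w_eq[symmetric])
  then obtain \<phi> where \<phi>: "\<phi> \<in> relative_automorphisms K L" "\<phi> \<alpha> = \<beta>"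
    using relative_automorphism_of_root[OF base_subfield generator \<beta>] by blast
  interpret relative_automorphism R K L \<phi>
    by unfold_locales (use extension \<phi> in auto)
  have "\<phi> (\<alpha> \<otimes> \<alpha>) \<noteq> \<alpha> \<otimes> \<alpha>"
  proof
    assume "\<phi> (\<alpha> \<otimes> \<alpha>) = \<alpha> \<otimes> \<alpha>"
    then have "\<alpha> \<otimes> \<alpha> \<oplus> \<alpha> \<otimes> \<alpha> = \<ominus> u"
      using u_eq generator_mem generator(1) by (simp add: hom_mult \<phi>(2))
    then show False
      using double_mem_subfield_iff[OF base_subfield char, of "\<alpha> \<otimes> \<alpha>"]
        subringE(5)[OF subfieldE(1)[OF base_subfield] coefficients(1)]
        generator_square_notin_base generator(1) by simp
  qed
  with \<phi>(1) show thesis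
    by (rule that)
qed

lemma constant_square_imp_galois:
  assumes "w \<in> squares L"
  shows "galois_extension K L"
proof (rule galois_extensionI[OF extension])
  show "(algebraic over K) x" if "x \<in> L" for x
    using simple_extesion_mem_imp_algebraic[OF base_subfield generator(1)] generator(2) that by blast
  obtain \<phi> where \<phi>: "\<phi> \<in> relative_automorphisms K L" "\<phi> \<alpha> = \<ominus> \<alpha>"
    by (rule negating_automorphism)
  obtain \<psi> where \<psi>: "\<psi> \<in> relative_automorphisms K L" "\<psi> (\<alpha> \<otimes> \<alpha>) \<noteq> \<alpha> \<otimes> \<alpha>"
    using automorphism_moving_generator_square[OF assms] .
  show "x \<in> K" if "x \<in> L" "\<And>\<chi>. \<chi> \<in> relative_automorphisms K L \<Longrightarrow> \<chi> x = x" for x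
    using fixed_imp_base[OF \<phi> \<psi> that(1)] that(2) \<phi>(1) \<psi>(1) by simp
qed

lemma galois_iff_constant_square: "galois_extension K L \<longleftrightarrow> w \<in> squares L"
  using galois_imp_constant_square constant_square_imp_galois by blast

lemma constant_root_mem_of_square:
  assumes \<omega>: "\<omega> \<in> carrier R" and square: "\<ominus> u \<oplus> [(2::nat)] \<cdot> \<omega> \<in> squares L"
  shows "\<omega> \<in> L"
proof -
  have double: "[(2::nat)] \<cdot> \<omega> = \<omega> \<oplus> \<omega>"
    using \<omega> by (simp add: numeral_2_eq_2)
  obtain y where y: "y \<in> L" "y \<otimes> y = \<ominus> u \<oplus> (\<omega> \<oplus> \<omega>)"
    using square mem_squares_iff[OF L_ring(1)] unfolding double by blast
  have "\<omega> \<oplus> \<omega> = y \<otimes> y \<oplus> u"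
    unfolding y(2) using \<omega> coefficients_closed(1) by algebra
  also have "\<dots> \<in> L"
    using y(1) coefficients(1) base_subset_L L_ring(6,7) by blast
  finally show ?thesis
    using double_mem_subfield_iff[OF subfield_L char \<omega>] by blast
qed

lemma squares_of_constant_root_mem:
  assumes \<omega>: "\<omega> \<in> L" "\<omega> \<otimes> \<omega> = w"
  shows "u [^] (2::nat) \<ominus> [(4::nat)] \<cdot> w \<in> squares L"
    and "\<ominus> u \<oplus> [(2::nat)] \<cdot> \<omega> \<in> squares L"
    and "\<ominus> u \<ominus> [(2::nat)] \<cdot> \<omega> \<in> squares L"
proof -
  obtain \<beta> where \<beta>: "\<beta> \<in> L" "\<alpha> \<otimes> \<beta> = \<omega>" and u_eq: "u = \<ominus> (\<alpha> \<otimes> \<alpha> \<oplus> \<beta> \<otimes> \<beta>)"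
    using complementary_root[OF \<omega>] by blast
  have \<beta>_closed: "\<beta> \<in> carrier R" and \<omega>_square: "\<omega> [^] (2::nat) = w"
    using \<beta>(1) \<omega> L_ring(1) by (auto simp: numeral_2_eq_2)
  note identities =
    biquadratic_square_identities[OF generator(1) \<beta>_closed u_eq, unfolded \<beta>(2) \<omega>_square]
  have "\<alpha> \<otimes> \<alpha> \<ominus> \<beta> \<otimes> \<beta> \<in> L" "\<alpha> \<oplus> \<beta> \<in> L" "\<alpha> \<ominus> \<beta> \<in> L"
    unfolding a_minus_def using generator_mem \<beta>(1) L_ring(5-7) by auto
  then show "u [^] (2::nat) \<ominus> [(4::nat)] \<cdot> w \<in> squares L"
    "\<ominus> u \<oplus> [(2::nat)] \<cdot> \<omega> \<in> squares L" "\<ominus> u \<ominus> [(2::nat)] \<cdot> \<omega> \<in> squares L"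
    unfolding mem_squares_iff[OF L_ring(1)] using identities by blast+
qed

lemma three_squares_iff_constant_square:
  assumes \<omega>: "\<omega> \<in> carrier R" "\<omega> [^] (2::nat) = w"
  shows "u [^] (2::nat) \<ominus> [(4::nat)] \<cdot> w \<in> squares L \<and>
      \<ominus> u \<oplus> [(2::nat)] \<cdot> \<omega> \<in> squares L \<and> \<ominus> u \<ominus> [(2::nat)] \<cdot> \<omega> \<in> squares L \<longleftrightarrow>
    w \<in> squares L"
proof -
  have "\<omega> \<otimes> \<omega> = w"
    using \<omega> by (simp add: numeral_2_eq_2)
  then show ?thesis
    using constant_root_mem_of_square[OF \<omega>(1)] squares_of_constant_root_mem
      square_mem_squares_iff[OF subfieldE(1)[OF subfield_L] \<omega>(1)] by blast
qed

end

theorem lemma2p6: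
  fixes \<Omega> (structure) and F L :: "'a set" and \<alpha> u w \<omega> :: 'a
  assumes closure: "algebraic_closure \<Omega> F"
    and char: "\<one> \<oplus> \<one> \<noteq> \<zero>"
    and ext: "ring.biquadratic_extension \<Omega> F L"
    and gen: "ring.biquadratic_generator \<Omega> F L \<alpha>"
    and uw: "u \<in> F" "w \<in> F"
    and minpoly: "ring.Irr \<Omega> F \<alpha> = ring.biquadratic_poly \<Omega> u w"
    and omega: "\<omega> \<in> carrier \<Omega>" "\<omega> [^] (2::nat) = w"
  shows "(ring.galois_extension \<Omega> F L \<longleftrightarrow>
            u [^] (2::nat) \<ominus> [(4::nat)] \<cdot> w \<in> ring.squares \<Omega> L \<and>
            \<ominus> u \<oplus> [(2::nat)] \<cdot> \<omega> \<in> ring.squares \<Omega> L \<and>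
            \<ominus> u \<ominus> [(2::nat)] \<cdot> \<omega> \<in> ring.squares \<Omega> L) \<and>
         (ring.galois_extension \<Omega> F L \<longleftrightarrow> w \<in> ring.squares \<Omega> L)"
proof -
  interpret algebraic_closure \<Omega> F by fact
  have F: "subfield F \<Omega>" and L: "subfield L \<Omega>"
    using ext unfolding biquadratic_extension_def subfield_extension_def by auto
  have \<alpha>: "\<alpha> \<in> carrier \<Omega>" "(algebraic over F) \<alpha>" and L_eq: "generate_field \<Omega> (insert \<alpha> F) = L"
    using gen subfieldE(3)[OF L] unfolding biquadratic_generator_def by auto
  interpret biquadratic_simple_extension \<Omega> F \<alpha> u w
    by unfold_locales (use char F \<alpha> uw minpoly in auto)
  show ?thesis
    using galois_iff_constant_square three_squares_iff_constant_square[OF omega]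
    unfolding generate_field_insert_algebraic[OF F \<alpha>, symmetric] L_eq by blast
qed

end
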